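(* For every uncountable compact line $L$, the compact line $K=L^\omega$ (the set of all sequences in $L$) endowed with the lexicographic order is not separably determined.
   Context: A compact line is a totally ordered set which is compact in its order topology; $L^\omega$ with the lexicographic order is a compact line. For a compact line $H$, $H^+$ is the set of right-isolated points of $H$ ($\max H$ or points with an immediate successor in $H$). $\mathrm{NBV}(K)$ is the space of right-continuous real maps of bounded variation on $K$, identified with $C(K)^*$ via $F_\mu(t)=\mu([\min K,t])$. $\lim_{i\in I}a_i=0$ means $\{i:|a_i|\ge\varepsilon\}$ is finite for each $\varepsilon>0$; $c_0(I)$ is the space of such families. $(F_i)_{i\in I}$ in $\mathrm{NBV}(K)$ is weak*-null if $\lim_{i\in I}\int f\,d\mu_i=0$ for all $f\in C(K)$, $\mu_i$ associated to $F_i$. $(F_i)$ is of type $c_0\ell_1$ over $Q\subseteq K$ if $F_i(t)=a_{i,t}+b_{i,t}$ ($i\in I$, $t\in Q$) with $\lim_{i\in I}a_{i,t}=0$ for each $t\in Q$ and $\sup_i\sum_{t\in Q}|b_{i,t}|<\infty$. A compact line $K$ is separably determined if for every weak*-null family $(F_i)_{i\in I}$ in $\mathrm{NBV}(K)$ and every $Q\subseteq K$: whenever $\{t\in Q\cap(H\setminus H^+):(F_i(t))_{i\in I}\notin c_0(I)\}$ is countable for every closed separable $H\subseteq K$, the family is of type $c_0\ell_1$ over $Q$. *)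

theory Defs
  imports "HOL-Analysis.Analysis" "HOL-Probability.Probability"
begin

definition ole :: "('k \<Rightarrow> 'k \<Rightarrow> bool) \<Rightarrow> 'k \<Rightarrow> 'k \<Rightarrow> bool" where
  "ole lt x y \<longleftrightarrow> lt x y \<or> x = y"

definition ord_top :: "('k \<Rightarrow> 'k \<Rightarrow> bool) \<Rightarrow> 'k set \<Rightarrow> 'k topology" where
  "ord_top lt K = topology_generated_by
     ({K} \<union> {{x\<in>K. lt x a} | a. a \<in> K} \<union> {{x\<in>K. lt a x} | a. a \<in> K})"

definition lmin :: "('k \<Rightarrow> 'k \<Rightarrow> bool) \<Rightarrow> 'k set \<Rightarrow> 'k" where
  "lmin lt K = (THE m. m \<in> K \<and> (\<forall>x\<in>K. ole lt m x))"

definition cinterval :: "('k \<Rightarrow> 'k \<Rightarrow> bool) \<Rightarrow> 'k set \<Rightarrow> 'k \<Rightarrow> 'k \<Rightarrow> 'k set" where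
  "cinterval lt K a b = {x\<in>K. ole lt a x \<and> ole lt x b}"

definition right_isolated :: "('k \<Rightarrow> 'k \<Rightarrow> bool) \<Rightarrow> 'k set \<Rightarrow> 'k set" where
  "right_isolated lt H = {t\<in>H. (\<forall>x\<in>H. ole lt x t) \<or>
      (\<exists>s\<in>H. lt t s \<and> \<not> (\<exists>u\<in>H. lt t u \<and> lt u s))}"

definition lex_less :: "(nat \<Rightarrow> 'a::linorder) \<Rightarrow> (nat \<Rightarrow> 'a) \<Rightarrow> bool" where
  "lex_less f g \<longleftrightarrow> (\<exists>n. (\<forall>m<n. f m = g m) \<and> f n < g n)"

definition radon_on :: "'k topology \<Rightarrow> 'k measure \<Rightarrow> bool" where
  "radon_on T M \<longleftrightarrow> space M = topspace T \<and>
     sets M = sigma_sets (topspace T) {U. openin T U} \<and>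
     finite_measure M \<and>
     (\<forall>B\<in>sets M. emeasure M B = (SUP C\<in>{C. compactin T C \<and> C \<subseteq> B}. emeasure M C))"

text \<open>A signed Radon measure is represented as a difference P - N of two finite Radon
  measures (Jordan decomposition).  Its NBV function is F(t) = mu([min K, t]).\<close>
definition nbv_of :: "('k \<Rightarrow> 'k \<Rightarrow> bool) \<Rightarrow> 'k set \<Rightarrow> 'k measure \<Rightarrow> 'k measure \<Rightarrow> 'k \<Rightarrow> real" where
  "nbv_of lt K P N t =
     measure P (cinterval lt K (lmin lt K) t) - measure N (cinterval lt K (lmin lt K) t)"

definition c0_fam :: "'i set \<Rightarrow> ('i \<Rightarrow> real) \<Rightarrow> bool" where
  "c0_fam I a \<longleftrightarrow> (\<forall>\<epsilon>>0. finite {i\<in>I. \<bar>a i\<bar> \<ge> \<epsilon>})"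

definition weak_star_null ::
  "('k \<Rightarrow> 'k \<Rightarrow> bool) \<Rightarrow> 'k set \<Rightarrow> 'i set \<Rightarrow> ('i \<Rightarrow> 'k measure) \<Rightarrow> ('i \<Rightarrow> 'k measure) \<Rightarrow> bool" where
  "weak_star_null lt K I P N \<longleftrightarrow>
     (\<forall>f. continuous_map (ord_top lt K) euclideanreal f \<longrightarrow>
        c0_fam I (\<lambda>i. integral\<^sup>L (P i) f - integral\<^sup>L (N i) f))"

definition type_c0l1 :: "'i set \<Rightarrow> ('i \<Rightarrow> 'k \<Rightarrow> real) \<Rightarrow> 'k set \<Rightarrow> bool" where
  "type_c0l1 I F Q \<longleftrightarrow>
     (\<exists>a b. (\<forall>i\<in>I. \<forall>t\<in>Q. F i t = a i t + b i t) \<and>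
            (\<forall>t\<in>Q. c0_fam I (\<lambda>i. a i t)) \<and>
            (\<exists>C. \<forall>i\<in>I. \<forall>S. S \<subseteq> Q \<and> finite S \<longrightarrow> (\<Sum>t\<in>S. \<bar>b i t\<bar>) \<le> C))"

definition separably_determined ::
  "('k \<Rightarrow> 'k \<Rightarrow> bool) \<Rightarrow> 'k set \<Rightarrow> 'i itself \<Rightarrow> bool" where
  "separably_determined lt K (_ :: 'i itself) \<longleftrightarrow>
     (\<forall>(I :: 'i set) (P :: 'i \<Rightarrow> 'k measure) (N :: 'i \<Rightarrow> 'k measure) (Q :: 'k set).
        (\<forall>i\<in>I. radon_on (ord_top lt K) (P i) \<and> radon_on (ord_top lt K) (N i)) \<and>
        weak_star_null lt K I P N \<and> Q \<subseteq> K \<and>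
        (\<forall>H. H \<subseteq> K \<and> closedin (ord_top lt K) H \<and>
             (\<exists>D. countable D \<and> D \<subseteq> H \<and> H \<subseteq> (ord_top lt K) closure_of D) \<longrightarrow>
             countable {t \<in> Q \<inter> (H - right_isolated lt H).
                          \<not> c0_fam I (\<lambda>i. nbv_of lt K (P i) (N i) t)})
        \<longrightarrow> type_c0l1 I (\<lambda>i. nbv_of lt K (P i) (N i)) Q)"

end

theory Submission
  imports Defs
begin

text \<open>For a finite sequence \<open>s\<close> in \<open>L\<close> let \<open>K\<^sub>s\<close> be the set of its extensions, an interval of \<open>K\<close>,
  and let \<open>\<mu>\<^sub>s\<close> be the point mass at \<open>max K\<^sub>s\<close> minus the point mass at \<open>min K\<^sub>s\<close>.  A continuous
  function oscillates by \<open>\<epsilon>\<close> or more on only finitely many \<open>K\<^sub>s\<close>: otherwise Koenig's lemma yields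
  a branch \<open>x\<close>, and the sets \<open>K\<^sub>s\<close> with \<open>s\<close> a prefix of \<open>x\<close> shrink to \<open>x\<close>, or else infinitely many
  children of one node, and these accumulate at an endpoint of some interval by compactness of
  \<open>L\<close>.  So the family is weak*-null, while \<open>F\<^sub>s(t) = -1\<close> for every prefix \<open>s\<close> of a
  sequence \<open>t\<close> that avoids the endpoints of \<open>L\<close>.

  As \<open>Q\<close> take Stone's set: embed \<open>\<omega>\<^sub>1\<close> into \<open>L\<close> without its endpoints, and for \<open>0 < \<alpha> < \<omega>\<^sub>1\<close> let
  \<open>e\<^sub>\<alpha>\<close> enumerate the predecessors of \<open>\<alpha>\<close>.  Points of \<open>Q\<close> in a separable set have all their values
  in a countable set, so there are countably many of them.  On the other hand \<open>Q\<close> is not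
  \<open>\<sigma>\<close>-discrete for the tree topology of \<open>L\<^sup>\<omega>\<close>, which is what a \<open>c\<^sub>0\<ell>\<^sub>1\<close> decomposition would imply.\<close>

section \<open>A set of sequences that is not \<open>\<sigma>\<close>-discrete\<close>

text \<open>Well-order \<open>U\<close>. If some initial segment is uncountable, cut at the least
  point with such a segment; minimality makes all segments inside the cut countable.
  \<open>W\<close> plays the role of \<omega>_1.\<close>

lemma uncountable_imp_omega1_subset:
  assumes "uncountable (U :: 'a set)"
  obtains W R where "W \<subseteq> U" "uncountable W" "wf R" "total_on W R"
    "\<And>a. a \<in> W \<Longrightarrow> countable {b\<in>W. (b, a) \<in> R}"
proof -
  obtain r where "well_order_on U r"
    using well_order_on by blast
  then have r: "wf (r - Id)" "total_on U (r - Id)"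
    by (auto simp: well_order_on_def linear_order_on_def)
  define Z where "Z = {a\<in>U. uncountable {b\<in>U. (b, a) \<in> r - Id}}"
  show thesis
  proof (cases "Z = {}")
    case True
    then show thesis
      using that[of U "r - Id"] assms r by (auto simp: Z_def)
  next
    case False
    then obtain a where a: "a \<in> Z" "\<And>b. (b, a) \<in> r - Id \<Longrightarrow> b \<notin> Z"
      using wfE_min'[OF r(1)] by blast
    define W where "W = {b\<in>U. (b, a) \<in> r - Id}"
    have "W \<subseteq> U" "uncountable W"
      using a by (auto simp: W_def Z_def)
    moreover have "total_on W (r - Id)"
      using r(2) \<open>W \<subseteq> U\<close> by (auto simp: total_on_def)
    moreover have "countable {c\<in>W. (c, b) \<in> r - Id}" if "b \<in> W" for b
    proof -
      have "countable {c\<in>U. (c, b) \<in> r - Id}"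
        using a(2)[of b] that by (auto simp: W_def Z_def)
      then show ?thesis
        by (rule countable_subset[rotated]) (auto simp: W_def)
    qed
    ultimately show thesis
      using that r(1) by blast
  qed
qed

text \<open>Close up in \<omega> stages. A list has finitely many entries, so it already lives in
  one stage and is served at the next.\<close>

lemma countable_closure_lists:
  assumes "countable A" "\<And>s. countable (G s)"
  obtains D where "A \<subseteq> D" "countable D" "\<And>s. s \<in> lists D \<Longrightarrow> G s \<subseteq> D"
proof -
  define \<Phi> where "\<Phi> X = X \<union> (\<Union>s\<in>lists X. G s)" for X
  define S where "S n = (\<Phi> ^^ n) A" for n
  have step: "S (Suc n) = S n \<union> (\<Union>s\<in>lists (S n). G s)" for n
    by (simp add: S_def \<Phi>_def)
  have mono: "S m \<subseteq> S n" if "m \<le> n" for m n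
    using that by (rule lift_Suc_mono_le[rotated]) (auto simp: step)
  have "countable (S n)" for n
  proof (induction n)
    case 0
    then show ?case
      using assms(1) by (simp add: S_def)
  next
    case (Suc n)
    then show ?case
      using assms(2) by (simp add: step)
  qed
  moreover
  have stage: "\<exists>n. s \<in> lists (S n)" if "s \<in> lists (\<Union>n. S n)" for s
    using that
  proof (induction s)
    case (Cons x s)
    then obtain m n where "x \<in> S m" "s \<in> lists (S n)"
      by auto
    then have "x # s \<in> lists (S (max m n))"
      using mono[of m "max m n"] lists_mono[OF mono[of n "max m n"]] by auto
    then show ?case ..
  qed simp
  have "G s \<subseteq> (\<Union>n. S n)" if s: "s \<in> lists (\<Union>n. S n)" for s
  proof -
    obtain n where "s \<in> lists (S n)"
      using stage[OF s] ..
    then have "G s \<subseteq> S (Suc n)"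
      unfolding step by auto
    then show ?thesis
      by auto
  qed
  moreover have "S 0 \<subseteq> (\<Union>n. S n)"
    by blast
  then have "A \<subseteq> (\<Union>n. S n)"
    by (simp add: S_def)
  ultimately show thesis
    using that[of "\<Union>n. S n"] by auto
qed

text \<open>The last clause is the usable form of not being \<sigma>-discrete: however the lengths
  \<open>h t\<close> are chosen, one list serves uncountably many points. It is proved by a
  pressing-down argument.\<close>

lemma stone_set:
  assumes "uncountable (U :: 'a set)"
  obtains Q :: "(nat \<Rightarrow> 'a) set"
  where "\<And>t. t \<in> Q \<Longrightarrow> range t \<subseteq> U"
    "\<And>V. countable V \<Longrightarrow> countable {t\<in>Q. range t \<subseteq> V}"
    "\<And>h. \<exists>s. uncountable {t\<in>Q. map t [0..<h t] = s}"
proof -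
  obtain W and R where W: "W \<subseteq> U" "uncountable W" "wf R" "total_on W R"
    and below_countable: "\<And>a. a \<in> W \<Longrightarrow> countable {b\<in>W. (b, a) \<in> R}"
    using uncountable_imp_omega1_subset[OF assms] by metis
  define below where "below a = {b\<in>W. (b, a) \<in> R}" for a
  \<comment> \<open>The least point of \<open>W\<close> has no predecessors to enumerate, so it is
    dropped. When \<open>below a\<close> is finite, \<open>e a\<close> repeats values.\<close>
  define W' where "W' = {a\<in>W. below a \<noteq> {}}"
  define e where "e a = from_nat_into (below a)" for a
  have range_e: "range (e a) = below a" if "a \<in> W'" for a
    using that below_countable[of a] by (simp add: e_def W'_def below_def)
  have "below a \<noteq> below b" if "a \<in> W" "b \<in> W" "a \<noteq> b" for a b
    using that W(3,4) unfolding total_on_def below_def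
    by (metis (no_types, lifting) mem_Collect_eq wf_not_refl)
  moreover have "a \<in> W" if "a \<in> W'" for a
    using that by (simp add: W'_def)
  ultimately have inj_e: "inj_on e W'"
    using range_e by (metis inj_onI)
  show thesis
  proof (rule that[of "e ` W'"])
    fix t assume "t \<in> e ` W'"
    then show "range t \<subseteq> U"
      using range_e W(1) by (auto simp: below_def)
  next
    fix V :: "'a set" assume "countable V"
    then have "uncountable (W - V)"
      using W(2) by (simp add: uncountable_minus_countable)
    then obtain c where c: "c \<in> W" "c \<notin> V"
      using countable_empty by (metis Diff_iff all_not_in_conv)
    have "{t \<in> e ` W'. range t \<subseteq> V} \<subseteq> e ` (insert c (below c))"
    proof clarify
      fix a assume a: "a \<in> W'" "range (e a) \<subseteq> V"
      then have "c \<notin> below a"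
        using range_e c by auto
      then have "a \<in> insert c (below c)"
        using W(4) c a(1) by (auto simp: total_on_def below_def W'_def)
      then show "e a \<in> e ` (insert c (below c))"
        by (rule imageI)
    qed
    moreover have "countable (e ` (insert c (below c)))"
      using below_countable c by (simp add: below_def)
    ultimately show "countable {t \<in> e ` W'. range t \<subseteq> V}"
      by (rule countable_subset)
  next
    fix h :: "(nat \<Rightarrow> 'a) \<Rightarrow> nat"
    show "\<exists>s. uncountable {t \<in> e ` W'. map t [0..<h t] = s}"
    proof (rule ccontr)
      assume "\<not> ?thesis"
      then have cnt: "countable {t \<in> e ` W'. map t [0..<h t] = s}" for s
        by auto
      define G where "G s = {a\<in>W'. map (e a) [0..<h (e a)] = s}" for s
      have G: "countable (G s)" for s
      proof (rule countable_image_inj_on[where f = e])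
        show "countable (e ` G s)"
          by (rule countable_subset[OF _ cnt[of s]]) (auto simp: G_def)
        show "inj_on e (G s)"
          by (rule inj_on_subset[OF inj_e]) (auto simp: G_def)
      qed
      \<comment> \<open>\<open>a0\<close> seeds \<open>D\<close>, so that \<open>\<delta>\<close>
        will have a predecessor and thus lie in \<open>W'\<close>.\<close>
      obtain a0 where a0: "a0 \<in> W"
        using W(2) by (metis countable_empty equals0I)
      text \<open>The countable set \<open>D\<close> is an initial segment closed under \<open>G\<close>; the enumeration of its
        supremum \<open>\<delta>\<close> starts with a list over \<open>D\<close>, so that \<open>\<delta>\<close> would itself lie in \<open>D\<close>.\<close>
      have "countable (G s \<union> (\<Union>a\<in>W \<inter> set s. below a))" for s
        using G below_countable
        by (intro countable_Un countable_UN) (auto simp: below_def intro: countable_finite)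
      then obtain D where D: "{a0} \<subseteq> D" "countable D"
        "\<And>s. s \<in> lists D \<Longrightarrow> G s \<union> (\<Union>a\<in>W \<inter> set s. below a) \<subseteq> D"
        using countable_closure_lists[of "{a0}" "\<lambda>s. G s \<union> (\<Union>a\<in>W \<inter> set s. below a)"]
        by (metis countable_empty countable_insert)
      have down: "below a \<subseteq> D" if "a \<in> D" "a \<in> W" for a
        using D(3)[of "[a]"] that by (auto simp: below_def)
      have "W - D \<noteq> {}"
        using W(2) D(2) countable_subset by (metis Diff_eq_empty_iff)
      then obtain \<delta> where \<delta>: "\<delta> \<in> W - D" "\<And>b. (b, \<delta>) \<in> R \<Longrightarrow> b \<notin> W - D"
        using wfE_min'[OF W(3)] by metis
      have sub: "below \<delta> \<subseteq> D"
        using \<delta>(2) by (auto simp: below_def)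
      have "a0 \<noteq> \<delta>" "(\<delta>, a0) \<notin> R"
        using \<delta>(1) D(1) down[of a0] a0 by (auto simp: below_def)
      then have "(a0, \<delta>) \<in> R"
        using W(4) \<delta>(1) a0 by (auto simp: total_on_def)
      then have "\<delta> \<in> W'"
        using \<delta>(1) a0 by (auto simp: W'_def below_def)
      have "e \<delta> n \<in> D" for n
        using range_e[OF \<open>\<delta> \<in> W'\<close>] sub by (metis rangeI subsetD)
      then have "map (e \<delta>) [0..<h (e \<delta>)] \<in> lists D"
        by auto
      from D(3)[OF this] have "\<delta> \<in> D"
        using \<open>\<delta> \<in> W'\<close> by (auto simp: G_def)
      then show False
        using \<delta>(1) by simp
    qed
  qed
qed

section \<open>The lexicographic order topology\<close>

lemma topspace_ord_top [simp]: "topspace (ord_top lt K) = K"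
  unfolding ord_top_def topology_generated_by_topspace by auto

lemma openin_ord_top_less: "a \<in> K \<Longrightarrow> openin (ord_top lt K) {x\<in>K. lt x a}"
  unfolding ord_top_def by (rule topology_generated_by_Basis) auto

lemma openin_ord_top_greater: "a \<in> K \<Longrightarrow> openin (ord_top lt K) {x\<in>K. lt a x}"
  unfolding ord_top_def by (rule topology_generated_by_Basis) auto

text \<open>Eventual membership survives finite intersections and arbitrary unions, so only rays
  have to be tested. The filter is general in order to cover both sequences and one-sided limits in
  L.\<close>

lemma limitin_ord_topI:
  assumes "z \<in> K" "\<forall>\<^sub>F i in F. g i \<in> K"
    and "\<And>u. u \<in> K \<Longrightarrow> lt u z \<Longrightarrow> \<forall>\<^sub>F i in F. lt u (g i)"
    and "\<And>v. v \<in> K \<Longrightarrow> lt z v \<Longrightarrow> \<forall>\<^sub>F i in F. lt (g i) v"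
  shows "limitin (ord_top lt K) g z F"
  unfolding limitin_def
proof (intro conjI allI impI)
  show "z \<in> topspace (ord_top lt K)"
    using assms by simp
next
  fix V assume V: "openin (ord_top lt K) V \<and> z \<in> V"
  then have "generate_topology_on
      ({K} \<union> {{x\<in>K. lt x a} | a. a \<in> K} \<union> {{x\<in>K. lt a x} | a. a \<in> K}) V"
    by (simp add: ord_top_def openin_topology_generated_by)
  then have "z \<in> V \<longrightarrow> (\<forall>\<^sub>F i in F. g i \<in> V)"
  proof induction
    case (Int a b)
    then show ?case
      by (simp add: eventually_conj_iff)
  next
    case (UN \<K>)
    show ?case
    proof
      assume "z \<in> \<Union> \<K>"
      then obtain X where "X \<in> \<K>" "z \<in> X"
        by blast
      then have "\<forall>\<^sub>F i in F. g i \<in> X"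
        using UN by simp
      then show "\<forall>\<^sub>F i in F. g i \<in> \<Union> \<K>"
        by (rule eventually_mono) (use \<open>X \<in> \<K>\<close> in blast)
    qed
  next
    case (Basis X)
    then consider "X = K" | u where "u \<in> K" "X = {x\<in>K. lt x u}"
      | u where "u \<in> K" "X = {x\<in>K. lt u x}"
      by blast
    then show ?case
      by cases (use assms in \<open>simp_all add: eventually_conj_iff\<close>)
  qed simp
  with V show "\<forall>\<^sub>F i in F. g i \<in> V"
    by simp
qed

lemma lex_less_asym: "lex_less f g \<Longrightarrow> \<not> lex_less g f"
  unfolding lex_less_def by (metis less_asym less_irrefl linorder_neqE_nat)

lemma lex_less_linear: "lex_less f g \<or> f = g \<or> lex_less g f"
proof (cases "f = g")
  case False
  then obtain n where "f n \<noteq> g n" "\<And>m. m < n \<Longrightarrow> f m = g m"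
    using exists_least_iff[of "\<lambda>n. f n \<noteq> g n"] by auto
  then show ?thesis
    unfolding lex_less_def by (metis linorder_neqE)
qed simp

lemma closedin_lex_singleton: "closedin (ord_top lex_less UNIV) {x}"
proof -
  have "UNIV - {x} = {y\<in>UNIV. lex_less y x} \<union> {y\<in>UNIV. lex_less x y}"
    using lex_less_linear[of _ x] lex_less_asym[of x] by auto
  moreover have "openin (ord_top lex_less UNIV) \<dots>"
    by (intro openin_Un openin_ord_top_less openin_ord_top_greater UNIV_I)
  ultimately show ?thesis
    by (simp add: closedin_def)
qed

section \<open>Cylinders and their endpoints\<close>

definition cyl :: "'a list \<Rightarrow> (nat \<Rightarrow> 'a) set" where
  "cyl s = {y. \<forall>m<length s. y m = s ! m}"

text \<open>When \<open>c\<close> is the least or the greatest element of L, this is the minimum or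
  the maximum of the interval \<open>cyl s\<close>.\<close>

definition pad :: "'a \<Rightarrow> 'a list \<Rightarrow> nat \<Rightarrow> 'a" where
  "pad c s m = (if m < length s then s ! m else c)"

lemma pad_in_cyl [simp]: "pad c s \<in> cyl s"
  by (simp add: cyl_def pad_def)

lemma pad_append_in_cyl [simp]: "pad c (s @ w) \<in> cyl s"
  by (simp add: cyl_def pad_def nth_append)

text \<open>Lets cylinders stand for finite sequences as indices. Padding \<open>s\<close> by two
  different values shows that the coordinate \<open>length s\<close> is free, so
  \<open>cyl s\<close> determines the length of \<open>s\<close>.\<close>

lemma inj_cyl:
  assumes "(c :: 'a) \<noteq> d"
  shows "inj (cyl :: 'a list \<Rightarrow> _)"
proof -
  have len: "length s' \<le> length s" if "cyl s = cyl s'" for s s' :: "'a list"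
  proof (rule ccontr)
    assume "\<not> ?thesis"
    moreover have "pad c s \<in> cyl s'" "pad d s \<in> cyl s'"
      using that pad_in_cyl by metis+
    ultimately have "pad c s (length s) = pad d s (length s)"
      by (simp add: cyl_def)
    with assms show False
      by (simp add: pad_def)
  qed
  show ?thesis
  proof (rule injI)
    fix s s' :: "'a list" assume eq: "cyl s = cyl s'"
    then have "length s = length s'"
      using len[of s s'] len[of s' s] by simp
    moreover have "pad c s \<in> cyl s'"
      using eq pad_in_cyl by metis
    ultimately show "s = s'"
      by (auto simp: cyl_def pad_def intro: nth_equalityI)
  qed
qed

lemma cyl_prefixD: "y \<in> cyl (map x [0..<n]) \<Longrightarrow> m < n \<Longrightarrow> y m = x m"
  by (simp add: cyl_def)

text \<open>Both pads begin with \<open>s\<close>, so a point that departs from \<open>s\<close>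
  lies on the same side of both.\<close>

lemma pad_less_pad_imp_cyl:
  assumes "lex_less (pad c s) y" "lex_less y (pad d s)"
  shows "y \<in> cyl s"
proof -
  obtain n where n: "\<And>m. m < n \<Longrightarrow> pad c s m = y m" "pad c s n < y n"
    using assms(1) by (auto simp: lex_less_def)
  obtain k where k: "\<And>m. m < k \<Longrightarrow> y m = pad d s m" "y k < pad d s k"
    using assms(2) by (auto simp: lex_less_def)
  have "length s \<le> n"
  proof (rule ccontr)
    assume "\<not> ?thesis"
    then have "pad c s m = pad d s m" if "m \<le> n" for m
      using that by (simp add: pad_def)
    then show False
      using n k by (metis less_imp_le less_irrefl linorder_neqE_nat order.asym order_refl)
  qed
  then show ?thesis
    using n(1) by (auto simp: cyl_def pad_def split: if_splits) (metis less_le_trans)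
qed

section \<open>Convergence of points chosen from cylinders\<close>

text \<open>A point other than \<open>x\<close> splits from it at some \<open>k\<close>, and from
  \<open>n = k + 1\<close> on \<open>g n\<close> agrees with \<open>x\<close> up to and including
  \<open>k\<close>.\<close>

lemma limitin_cyl_branch:
  assumes "\<And>n. g n \<in> cyl (map x [0..<n])"
  shows "limitin (ord_top lex_less UNIV) g x sequentially"
proof (rule limitin_ord_topI)
  fix u assume "lex_less u x"
  then obtain k where k: "\<forall>m<k. u m = x m" "u k < x k"
    by (auto simp: lex_less_def)
  have "lex_less u (g n)" if "n \<ge> Suc k" for n
    unfolding lex_less_def using that k cyl_prefixD[OF assms[of n]]
    by (intro exI[of _ k]) auto
  then show "\<forall>\<^sub>F n in sequentially. lex_less u (g n)"
    by (rule eventually_sequentiallyI)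
next
  fix v assume "lex_less x v"
  then obtain k where k: "\<forall>m<k. x m = v m" "x k < v k"
    by (auto simp: lex_less_def)
  have "lex_less (g n) v" if "n \<ge> Suc k" for n
    unfolding lex_less_def using that k cyl_prefixD[OF assms[of n]]
    by (intro exI[of _ k]) auto
  then show "\<forall>\<^sub>F n in sequentially. lex_less (g n) v"
    by (rule eventually_sequentiallyI)
qed auto

lemma cyl_appendD:
  assumes "y \<in> cyl (s @ [a])"
  shows "m < length s \<Longrightarrow> y m = s ! m" "y (length s) = a"
  using assms by (auto simp: cyl_def nth_append)

text \<open>Whichever points are picked, they converge to the minimum of
  \<open>cyl (s @ [p])\<close>. A point below it splits from it no later than at coordinate
  \<open>length s\<close>, since all later entries are the least element \<open>z\<close>; if
  exactly there, then \<open>a\<close> near \<open>p\<close> exceeds its entry.\<close>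

lemma limitin_cyl_left:
  fixes p z :: "'a::linorder_topology"
  assumes z: "\<And>a. z \<le> a"
    and g: "\<And>a. a \<in> A \<Longrightarrow> g a \<in> cyl (s @ [a])"
  shows "limitin (ord_top lex_less UNIV) g (pad z (s @ [p])) (at p within A \<inter> {..<p})"
proof (rule limitin_ord_topI)
  fix u assume "lex_less u (pad z (s @ [p]))"
  then obtain k where k: "\<forall>m<k. u m = pad z (s @ [p]) m" "u k < pad z (s @ [p]) k"
    by (auto simp: lex_less_def)
  have "\<not> length s < k"
    using k(2) z[of "u k"] by (auto simp: pad_def)
  then consider "k < length s" | "k = length s"
    by linarith
  then show "\<forall>\<^sub>F a in at p within A \<inter> {..<p}. lex_less u (g a)"
  proof cases
    case 1
    then have "lex_less u (g a)" if "a \<in> A" for a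
      unfolding lex_less_def using k cyl_appendD(1)[OF g[OF that]]
      by (intro exI[of _ k]) (auto simp: pad_def nth_append)
    then show ?thesis
      by (simp add: eventually_at_filter)
  next
    case 2
    then have up: "u k < p"
      using k(2) by (simp add: pad_def)
    have "lex_less u (g a)" if "a \<in> A" "u k < a" for a
      unfolding lex_less_def using k 2 that cyl_appendD[OF g[OF that(1)]]
      by (intro exI[of _ k]) (auto simp: pad_def nth_append)
    moreover have "\<forall>\<^sub>F a in nhds p. u k < a"
      using up by (rule order_tendstoD[OF filterlim_ident])
    ultimately show ?thesis
      by (auto simp: eventually_at_filter elim: eventually_mono)
  qed
next
  fix v assume "lex_less (pad z (s @ [p])) v"
  then obtain k where k: "\<forall>m<k. pad z (s @ [p]) m = v m" "pad z (s @ [p]) k < v k"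
    by (auto simp: lex_less_def)
  have "lex_less (g a) v" if "a \<in> A" "a < p" for a
  proof (cases "k < length s")
    case True
    then show ?thesis
      unfolding lex_less_def using k cyl_appendD(1)[OF g[OF that(1)]]
      by (intro exI[of _ k]) (auto simp: pad_def nth_append)
  next
    case False
    then have "p \<le> v (length s)"
      using k by (cases "k = length s") (auto simp: pad_def dest: spec[of _ "length s"])
    moreover have "pad z (s @ [p]) m = s ! m" if "m < length s" for m
      using that by (simp add: pad_def nth_append)
    ultimately show ?thesis
      unfolding lex_less_def using False k(1) \<open>a < p\<close> cyl_appendD[OF g[OF that(1)]]
      by (intro exI[of _ "length s"]) auto
  qed
  then show "\<forall>\<^sub>F a in at p within A \<inter> {..<p}. lex_less (g a) v"
    by (simp add: eventually_at_filter)
qed auto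

text \<open>Mirror image of \<open>limitin_cyl_left\<close>: from the right the limit is the maximum
  of \<open>cyl (s @ [p])\<close>.\<close>

lemma limitin_cyl_right:
  fixes p w :: "'a::linorder_topology"
  assumes w: "\<And>a. a \<le> w"
    and g: "\<And>a. a \<in> A \<Longrightarrow> g a \<in> cyl (s @ [a])"
  shows "limitin (ord_top lex_less UNIV) g (pad w (s @ [p])) (at p within A \<inter> {p<..})"
proof (rule limitin_ord_topI)
  fix v assume "lex_less (pad w (s @ [p])) v"
  then obtain k where k: "\<forall>m<k. pad w (s @ [p]) m = v m" "pad w (s @ [p]) k < v k"
    by (auto simp: lex_less_def)
  have "\<not> length s < k"
    using k(2) w[of "v k"] by (auto simp: pad_def)
  then consider "k < length s" | "k = length s"
    by linarith
  then show "\<forall>\<^sub>F a in at p within A \<inter> {p<..}. lex_less (g a) v"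
  proof cases
    case 1
    then have "lex_less (g a) v" if "a \<in> A" for a
      unfolding lex_less_def using k cyl_appendD(1)[OF g[OF that]]
      by (intro exI[of _ k]) (auto simp: pad_def nth_append)
    then show ?thesis
      by (simp add: eventually_at_filter)
  next
    case 2
    then have pv: "p < v k"
      using k(2) by (simp add: pad_def)
    have "lex_less (g a) v" if "a \<in> A" "a < v k" for a
      unfolding lex_less_def using k 2 that cyl_appendD[OF g[OF that(1)]]
      by (intro exI[of _ k]) (auto simp: pad_def nth_append)
    moreover have "\<forall>\<^sub>F a in nhds p. a < v k"
      using pv by (rule order_tendstoD[OF filterlim_ident])
    ultimately show ?thesis
      by (auto simp: eventually_at_filter elim: eventually_mono)
  qed
next
  fix u assume "lex_less u (pad w (s @ [p]))"
  then obtain k where k: "\<forall>m<k. u m = pad w (s @ [p]) m" "u k < pad w (s @ [p]) k"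
    by (auto simp: lex_less_def)
  have "lex_less u (g a)" if "a \<in> A" "p < a" for a
  proof (cases "k < length s")
    case True
    then show ?thesis
      unfolding lex_less_def using k cyl_appendD(1)[OF g[OF that(1)]]
      by (intro exI[of _ k]) (auto simp: pad_def nth_append)
  next
    case False
    then have "u (length s) \<le> p"
      using k by (cases "k = length s") (auto simp: pad_def dest: spec[of _ "length s"])
    moreover have "pad w (s @ [p]) m = s ! m" if "m < length s" for m
      using that by (simp add: pad_def nth_append)
    ultimately show ?thesis
      unfolding lex_less_def using False k(1) \<open>p < a\<close> cyl_appendD[OF g[OF that(1)]]
      by (intro exI[of _ "length s"]) auto
  qed
  then show "\<forall>\<^sub>F a in at p within A \<inter> {p<..}. lex_less u (g a)"
    by (simp add: eventually_at_filter)
qed auto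

section \<open>Oscillation on cylinders\<close>

text \<open>By \<open>split\<close>, no node has infinitely many children with extensions in
  \<open>B\<close>, so the tree of initial segments of \<open>B\<close> is finitely branching and
  Koenig's lemma applies.\<close>

lemma koenig_branch:
  assumes "infinite (B :: 'a list set)"
    and split: "\<And>s A r. infinite A \<Longrightarrow> (\<And>a. a \<in> A \<Longrightarrow> (s @ [a]) @ r a \<in> B) \<Longrightarrow> False"
  shows "\<exists>x r. \<forall>n. map x [0..<n] @ r n \<in> B"
proof -
  define E where "E s = {b\<in>B. \<exists>w. b = s @ w}" for s
  have child: "\<exists>a. infinite (E (s @ [a]))" if "infinite (E s)" for s
  proof (rule ccontr)
    assume "\<not> ?thesis"
    then have fin: "finite (E (s @ [a]))" for a
      by simp
    define A where "A = {a. E (s @ [a]) \<noteq> {}}"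
    have "E s \<subseteq> insert s (\<Union>a\<in>A. E (s @ [a]))"
    proof
      fix b assume "b \<in> E s"
      then obtain w where w: "b \<in> B" "b = s @ w"
        by (auto simp: E_def)
      show "b \<in> insert s (\<Union>a\<in>A. E (s @ [a]))"
      proof (cases w)
        case (Cons a w')
        then have "b \<in> E (s @ [a])"
          using w by (simp add: E_def)
        then show ?thesis
          by (auto simp: A_def)
      qed (use w in simp)
    qed
    then have "infinite A"
      using that fin by (metis finite_UN_I finite_insert finite_subset)
    moreover have "\<forall>a\<in>A. \<exists>w. (s @ [a]) @ w \<in> B"
      by (auto simp: A_def E_def)
    then obtain r where "\<And>a. a \<in> A \<Longrightarrow> (s @ [a]) @ r a \<in> B"
      by metis
    ultimately show False
      by (rule split)
  qed
  have "\<exists>\<sigma>. \<forall>n. (infinite (E (\<sigma> n)) \<and> length (\<sigma> n) = n) \<and> (\<exists>a. \<sigma> (Suc n) = \<sigma> n @ [a])"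
  proof (rule dependent_nat_choice)
    show "\<exists>s. infinite (E s) \<and> length s = 0"
      using assms(1) by (auto simp: E_def)
  next
    fix s :: "'a list" and n
    assume "infinite (E s) \<and> length s = n"
    then show "\<exists>s'. (infinite (E s') \<and> length s' = Suc n) \<and> (\<exists>a. s' = s @ [a])"
      using child[of s] by auto
  qed
  then obtain \<sigma> where \<sigma>: "\<And>n. infinite (E (\<sigma> n))" "\<And>n. length (\<sigma> n) = n"
    "\<And>n. \<exists>a. \<sigma> (Suc n) = \<sigma> n @ [a]"
    by blast
  define x where "x n = \<sigma> (Suc n) ! n" for n
  have "\<sigma> n = map x [0..<n]" for n
  proof (induction n)
    case 0
    then show ?case
      using \<sigma>(2)[of 0] by simp
  next
    case (Suc n)
    obtain a where "\<sigma> (Suc n) = \<sigma> n @ [a]"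
      using \<sigma>(3) by blast
    then show ?case
      using Suc \<sigma>(2)[of n] by (simp add: x_def nth_append)
  qed
  moreover have "\<forall>n. \<exists>w. \<sigma> n @ w \<in> B"
  proof
    fix n
    have "E (\<sigma> n) \<noteq> {}"
      using \<sigma>(1)[of n] by auto
    then show "\<exists>w. \<sigma> n @ w \<in> B"
      by (auto simp: E_def)
  qed
  then obtain r where "\<And>n. \<sigma> n @ r n \<in> B"
    by metis
  ultimately show ?thesis
    by metis
qed

text \<open>The images of both nets converge to \<open>f l\<close>, so their distance tends to 0.
  This gives the contradiction in all three limit situations of
  \<open>finite_oscillating_cyl\<close>.\<close>

lemma continuous_map_diff_frequently_small:
  assumes f: "continuous_map X euclideanreal f"
    and lim: "limitin X g l F" "limitin X g' l F"
    and "F \<noteq> bot" "\<epsilon> > 0" "\<forall>\<^sub>F i in F. \<epsilon> \<le> \<bar>f (g i) - f (g' i)\<bar>"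
  shows False
proof -
  have "((f \<circ> g) \<longlongrightarrow> f l) F" "((f \<circ> g') \<longlongrightarrow> f l) F"
    using continuous_map_limit[OF f lim(1)] continuous_map_limit[OF f lim(2)] by simp_all
  then have "((\<lambda>i. \<bar>f (g i) - f (g' i)\<bar>) \<longlongrightarrow> \<bar>f l - f l\<bar>) F"
    unfolding comp_def by (intro tendsto_intros)
  then have "\<forall>\<^sub>F i in F. \<bar>f (g i) - f (g' i)\<bar> < \<epsilon>"
    using \<open>\<epsilon> > 0\<close> by (intro order_tendstoD(2)) auto
  then have "\<forall>\<^sub>F i in F. False"
    using assms(6) by eventually_elim simp
  then show False
    using \<open>F \<noteq> bot\<close> by (simp add: trivial_limit_def)
qed

text \<open>The difference is the integral of \<open>f\<close> against the measure attached to
  \<open>s\<close>, so this is the weak*-nullness of the family.\<close>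

lemma finite_oscillating_cyl:
  fixes z w :: "'a::linorder_topology"
  assumes comp: "compact (UNIV :: 'a set)"
    and zw: "\<And>a. z \<le> a" "\<And>a. a \<le> w"
    and f: "continuous_map (ord_top lex_less UNIV) euclideanreal f"
    and \<epsilon>: "\<epsilon> > 0"
  shows "finite {s. \<epsilon> \<le> \<bar>f (pad w s) - f (pad z s)\<bar>}" (is "finite ?B")
proof (rule ccontr)
  assume inf: "infinite ?B"
  have split: False
    if A: "infinite A" and r: "\<And>a. a \<in> A \<Longrightarrow> (s @ [a]) @ r a \<in> ?B" for s A r
  proof -
    obtain p where "p islimpt A"
      using Heine_Borel_imp_Bolzano_Weierstrass[OF comp A] by auto
    \<comment> \<open>The set accumulates at \<open>p\<close> from at least one side. From the left
      the endpoints tend to the minimum of \<open>cyl (s @ [p])\<close>, from the right to its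
      maximum.\<close>
    then have "p islimpt (A \<inter> {..<p} \<union> A \<inter> {p<..})"
      unfolding islimpt_def by (metis IntI UnI1 UnI2 greaterThan_iff lessThan_iff linorder_neqE)
    then consider "p islimpt (A \<inter> {..<p})" | "p islimpt (A \<inter> {p<..})"
      by (auto simp: islimpt_Un)
    then show ?thesis
    proof cases
      case 1
      show ?thesis
      proof (rule continuous_map_diff_frequently_small[OF f])
        show "limitin (ord_top lex_less UNIV) (\<lambda>a. pad w ((s @ [a]) @ r a)) (pad z (s @ [p]))
            (at p within A \<inter> {..<p})"
          by (rule limitin_cyl_left[OF zw(1) pad_append_in_cyl])
        show "limitin (ord_top lex_less UNIV) (\<lambda>a. pad z ((s @ [a]) @ r a)) (pad z (s @ [p]))
            (at p within A \<inter> {..<p})"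
          by (rule limitin_cyl_left[OF zw(1) pad_append_in_cyl])
        show "at p within A \<inter> {..<p} \<noteq> bot"
          using 1 by (simp add: trivial_limit_within)
        show "\<forall>\<^sub>F a in at p within A \<inter> {..<p}.
            \<epsilon> \<le> \<bar>f (pad w ((s @ [a]) @ r a)) - f (pad z ((s @ [a]) @ r a))\<bar>"
          using r by (simp add: eventually_at_filter)
      qed (fact \<epsilon>)
    next
      case 2
      show ?thesis
      proof (rule continuous_map_diff_frequently_small[OF f])
        show "limitin (ord_top lex_less UNIV) (\<lambda>a. pad w ((s @ [a]) @ r a)) (pad w (s @ [p]))
            (at p within A \<inter> {p<..})"
          by (rule limitin_cyl_right[OF zw(2) pad_append_in_cyl])
        show "limitin (ord_top lex_less UNIV) (\<lambda>a. pad z ((s @ [a]) @ r a)) (pad w (s @ [p]))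
            (at p within A \<inter> {p<..})"
          by (rule limitin_cyl_right[OF zw(2) pad_append_in_cyl])
        show "at p within A \<inter> {p<..} \<noteq> bot"
          using 2 by (simp add: trivial_limit_within)
        show "\<forall>\<^sub>F a in at p within A \<inter> {p<..}.
            \<epsilon> \<le> \<bar>f (pad w ((s @ [a]) @ r a)) - f (pad z ((s @ [a]) @ r a))\<bar>"
          using r by (simp add: eventually_at_filter)
      qed (fact \<epsilon>)
    qed
  qed
  have "\<exists>x r. \<forall>n. map x [0..<n] @ r n \<in> ?B"
    by (rule koenig_branch[OF inf]) (rule split)
  then obtain x r where xr: "\<And>n. map x [0..<n] @ r n \<in> ?B"
    by blast
  show False
  proof (rule continuous_map_diff_frequently_small[OF f])
    show "limitin (ord_top lex_less UNIV) (\<lambda>n. pad w (map x [0..<n] @ r n)) x sequentially"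
      and "limitin (ord_top lex_less UNIV) (\<lambda>n. pad z (map x [0..<n] @ r n)) x sequentially"
      by (rule limitin_cyl_branch[OF pad_append_in_cyl])+
  qed (use xr \<epsilon> in auto)
qed

section \<open>Point masses\<close>

definition borel_alg :: "'k topology \<Rightarrow> 'k measure" where
  "borel_alg T = sigma (topspace T) {U. openin T U}"

lemma space_borel_alg [simp]: "space (borel_alg T) = topspace T"
  and sets_borel_alg: "sets (borel_alg T) = sigma_sets (topspace T) {U. openin T U}"
  by (auto simp: borel_alg_def dest: openin_subset intro!: space_measure_of sets_measure_of)

lemma openin_borel_alg: "openin T U \<Longrightarrow> U \<in> sets (borel_alg T)"
  by (auto simp: sets_borel_alg)

text \<open>If \<open>x\<close> lies in \<open>B\<close>, the compact set \<open>{x}\<close> attains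
  the measure of \<open>B\<close>, and it is measurable because it is closed; otherwise
  \<open>B\<close> has measure 0.\<close>

lemma radon_on_return:
  assumes "closedin T {x}"
  shows "radon_on T (return (borel_alg T) x)"
  unfolding radon_on_def
proof (intro conjI ballI)
  show "finite_measure (return (borel_alg T) x)"
    using closedin_subset[OF assms] by (intro prob_space.finite_measure prob_space_return) simp
next
  fix B assume "B \<in> sets (return (borel_alg T) x)"
  then have B: "B \<in> sets (borel_alg T)"
    by simp
  let ?C = "{C. compactin T C \<and> C \<subseteq> B}"
  show "emeasure (return (borel_alg T) x) B = (SUP C\<in>?C. emeasure (return (borel_alg T) x) C)"
  proof (rule antisym)
    show "(SUP C\<in>?C. emeasure (return (borel_alg T) x) C) \<le> emeasure (return (borel_alg T) x) B"
      using B by (intro SUP_least emeasure_mono) auto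
    show "emeasure (return (borel_alg T) x) B \<le> (SUP C\<in>?C. emeasure (return (borel_alg T) x) C)"
    proof (cases "x \<in> B")
      case True
      have "space (borel_alg T) - (topspace T - {x}) \<in> sets (borel_alg T)"
        using assms by (intro sets.compl_sets openin_borel_alg) (simp add: closedin_def)
      moreover have "space (borel_alg T) - (topspace T - {x}) = {x}"
        using closedin_subset[OF assms] by auto
      ultimately have "{x} \<in> sets (borel_alg T)"
        by metis
      moreover have "{x} \<in> ?C"
        using True closedin_subset[OF assms] by (simp add: finite_imp_compactin)
      ultimately show ?thesis
        using B True by (intro SUP_upper2[of "{x}"]) auto
    next
      case False
      then show ?thesis
        using B by simp
    qed
  qed
qed (simp_all add: sets_borel_alg)

lemma borel_measurable_continuous_map:
  assumes "continuous_map T euclideanreal f"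
  shows "f \<in> borel_measurable (borel_alg T)"
proof (rule borel_measurableI)
  fix S :: "real set" assume "open S"
  then have "openin T {x \<in> topspace T. f x \<in> S}"
    using assms by (auto simp: continuous_map_def)
  moreover have "f -` S \<inter> space (borel_alg T) = {x \<in> topspace T. f x \<in> S}"
    by auto
  ultimately show "f -` S \<inter> space (borel_alg T) \<in> sets (borel_alg T)"
    by (simp add: openin_borel_alg)
qed

lemma lmin_lex:
  assumes z: "\<And>a. z \<le> a"
  shows "lmin lex_less UNIV = (\<lambda>_. z)" and "ole lex_less (\<lambda>_. z) x"
proof -
  have least: "ole lex_less (\<lambda>_. z) x" for x
    using lex_less_linear[of "\<lambda>_. z" x] z leD by (fastforce simp: ole_def lex_less_def)
  then show "ole lex_less (\<lambda>_. z) x" .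
  show "lmin lex_less UNIV = (\<lambda>_. z)"
    unfolding lmin_def
  proof (rule the_equality)
    fix m :: "nat \<Rightarrow> 'a" assume "m \<in> UNIV \<and> (\<forall>x\<in>UNIV. ole lex_less m x)"
    then have "ole lex_less m (\<lambda>_. z)"
      by blast
    then show "m = (\<lambda>_. z)"
      using least[of m] lex_less_asym[of m] by (auto simp: ole_def)
  qed (simp add: least)
qed

text \<open>The interval up to \<open>t\<close> is the complement of an open ray, hence
  measurable.\<close>

lemma nbv_of_lex_return:
  fixes t :: "nat \<Rightarrow> 'a::linorder"
  assumes z: "\<And>a :: 'a. z \<le> a"
  defines "M \<equiv> borel_alg (ord_top lex_less UNIV)"
  shows "nbv_of lex_less UNIV (return M x) (return M y) t
    = indicator {u. \<not> lex_less t u} x - indicator {u. \<not> lex_less t u} y"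
proof -
  have c: "cinterval lex_less UNIV (lmin lex_less UNIV) t = {u. \<not> lex_less t u}"
    using lmin_lex[OF z] lex_less_linear[of _ t] lex_less_asym[of t]
    by (auto simp: cinterval_def ole_def)
  have "space M - {u\<in>UNIV. lex_less t u} \<in> sets M"
    unfolding M_def by (intro sets.compl_sets openin_borel_alg openin_ord_top_greater UNIV_I)
  moreover have "space M - {u\<in>UNIV. lex_less t u} = {u. \<not> lex_less t u}"
    by (auto simp: M_def)
  ultimately have "{u. \<not> lex_less t u} \<in> sets M"
    by metis
  then show ?thesis
    unfolding nbv_of_def c by (simp add: measure_return)
qed

section \<open>The family of endpoint masses and the contradiction\<close>

theorem theorem4p6:
  assumes "compact (UNIV :: 'a::linorder_topology set)"
    and "uncountable (UNIV :: 'a set)"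
  shows "\<not> separably_determined (lex_less :: (nat \<Rightarrow> 'a) \<Rightarrow> (nat \<Rightarrow> 'a) \<Rightarrow> bool) UNIV
            TYPE((nat \<Rightarrow> 'a) set)"
proof
  assume sd: "separably_determined (lex_less :: (nat \<Rightarrow> 'a) \<Rightarrow> (nat \<Rightarrow> 'a) \<Rightarrow> bool) UNIV
            TYPE((nat \<Rightarrow> 'a) set)"
  let ?T = "ord_top (lex_less :: (nat \<Rightarrow> 'a) \<Rightarrow> _) UNIV"
  obtain z where z: "\<And>a :: 'a. z \<le> a"
    using compact_attains_inf[OF assms(1)] by auto
  obtain w where w: "\<And>a :: 'a. a \<le> w"
    using compact_attains_sup[OF assms(1)] by auto
  have "z \<noteq> w"
  proof
    assume "z = w"
    then have "a = z" for a :: 'a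
      using z[of a] w[of a] by simp
    then have "UNIV = {z}"
      by auto
    then show False
      using assms(2) by (metis countable_finite finite.emptyI finite_insert)
  qed
  note inj = inj_cyl[OF this]
  \<comment> \<open>Entries other than \<open>z\<close> and \<open>w\<close> put each
    \<open>t\<close> in \<open>Q\<close> strictly between the endpoints of every cylinder around
    it.\<close>
  have "uncountable (UNIV - {z, w})"
    using assms(2) by (simp add: uncountable_minus_countable)
  from stone_set[OF this] obtain Q :: "(nat \<Rightarrow> 'a) set" where Q:
    "\<And>t. t \<in> Q \<Longrightarrow> range t \<subseteq> UNIV - {z, w}"
    "\<And>V. countable V \<Longrightarrow> countable {t\<in>Q. range t \<subseteq> V}"
    "\<And>h. \<exists>s. uncountable {t\<in>Q. map t [0..<h t] = s}"
    by blast

  define s_of where "s_of i = inv cyl i" for i :: "(nat \<Rightarrow> 'a) set"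
  have s_of [simp]: "s_of (cyl s) = s" for s
    by (simp add: s_of_def inj)
  define I where "I = range (cyl :: 'a list \<Rightarrow> _)"
  define P where "P i = return (borel_alg ?T) (pad w (s_of i))" for i
  define N where "N i = return (borel_alg ?T) (pad z (s_of i))" for i
  define F where "F i = nbv_of lex_less UNIV (P i) (N i)" for i

  have radon: "radon_on ?T (P i)" "radon_on ?T (N i)" for i
    by (simp_all add: P_def N_def radon_on_return closedin_lex_singleton)

  have null: "weak_star_null lex_less UNIV I P N"
    unfolding weak_star_null_def c0_fam_def
  proof (intro allI impI)
    fix f and \<epsilon> :: real
    assume f: "continuous_map ?T euclideanreal f" and "\<epsilon> > 0"
    have "integral\<^sup>L (P i) f = f (pad w (s_of i))" "integral\<^sup>L (N i) f = f (pad z (s_of i))" for i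
      using borel_measurable_continuous_map[OF f] by (simp_all add: P_def N_def integral_return)
    then have "{i\<in>I. \<epsilon> \<le> \<bar>integral\<^sup>L (P i) f - integral\<^sup>L (N i) f\<bar>}
        \<subseteq> cyl ` {s. \<epsilon> \<le> \<bar>f (pad w s) - f (pad z s)\<bar>}"
      by (auto simp: I_def)
    then show "finite {i\<in>I. \<epsilon> \<le> \<bar>integral\<^sup>L (P i) f - integral\<^sup>L (N i) f\<bar>}"
      using finite_oscillating_cyl[OF assms(1) z w f \<open>\<epsilon> > 0\<close>] finite_surj by blast
  qed

  have between: "lex_less (pad z (map t [0..<n])) t" "lex_less t (pad w (map t [0..<n]))"
    if "t \<in> Q" for t n
  proof -
    have "z < t n" "t n < w"
      using Q(1)[OF that] z[of "t n"] w[of "t n"] by (auto simp: less_le)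
    then show "lex_less (pad z (map t [0..<n])) t" "lex_less t (pad w (map t [0..<n]))"
      by (auto simp: lex_less_def pad_def intro!: exI[of _ n])
  qed

  have small: "countable {t \<in> Q \<inter> (H - right_isolated lex_less H). \<not> c0_fam I (\<lambda>i. F i t)}"
    if "countable D" "H \<subseteq> ?T closure_of D" for H D
  proof (rule countable_subset)
    let ?V = "\<Union>d\<in>D. range d"
    show "countable {t\<in>Q. range t \<subseteq> ?V}"
      using that(1) by (intro Q(2)) auto
    have "t n \<in> ?V" if t: "t \<in> Q" "t \<in> H" for t n
    proof -
      let ?s = "map t [0..<Suc n]"
      \<comment> \<open>A member of \<open>D\<close> in this open interval shares its first
        \<open>Suc n\<close> entries with \<open>t\<close>, so the entry \<open>t n\<close> is among
        the countably many entries of members of \<open>D\<close>.\<close>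
      define U where "U = {x\<in>UNIV. lex_less (pad z ?s) x} \<inter> {x\<in>UNIV. lex_less x (pad w ?s)}"
      have "openin ?T U"
        unfolding U_def by (intro openin_Int openin_ord_top_less openin_ord_top_greater UNIV_I)
      moreover have "t \<in> U"
        using between[OF t(1), of "Suc n"] by (simp add: U_def)
      moreover have "t \<in> ?T closure_of D"
        using t(2) \<open>H \<subseteq> ?T closure_of D\<close> by blast
      ultimately obtain d where d: "d \<in> D" "d \<in> U"
        unfolding in_closure_of by metis
      then have "d \<in> cyl ?s"
        using pad_less_pad_imp_cyl[of z ?s d w] by (simp add: U_def)
      then have "d n = t n"
        by (rule cyl_prefixD) simp
      then show ?thesis
        using d(1) by (metis UN_I rangeI)
    qed
    then show "{t \<in> Q \<inter> (H - right_isolated lex_less H). \<not> c0_fam I (\<lambda>i. F i t)}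
        \<subseteq> {t\<in>Q. range t \<subseteq> ?V}"
      by blast
  qed

  have "type_c0l1 I (\<lambda>i. nbv_of lex_less UNIV (P i) (N i)) Q"
  proof (rule sd[unfolded separably_determined_def, rule_format], intro conjI ballI allI impI)
    fix H :: "(nat \<Rightarrow> 'a) set"
    assume "H \<subseteq> UNIV \<and> closedin ?T H \<and> (\<exists>D. countable D \<and> D \<subseteq> H \<and> H \<subseteq> ?T closure_of D)"
    then obtain D where "countable D" "H \<subseteq> ?T closure_of D"
      by metis
    then show "countable {t \<in> Q \<inter> (H - right_isolated lex_less H).
        \<not> c0_fam I (\<lambda>i. nbv_of lex_less UNIV (P i) (N i) t)}"
      by (rule small[unfolded F_def])
  qed (use radon null in simp_all)
  then have "type_c0l1 I F Q"
    by (simp add: F_def[abs_def])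
  then obtain a b C where ab: "\<And>i t. i \<in> I \<Longrightarrow> t \<in> Q \<Longrightarrow> F i t = a i t + b i t"
    and a: "\<And>t. t \<in> Q \<Longrightarrow> c0_fam I (\<lambda>i. a i t)"
    and C: "\<And>i S. i \<in> I \<Longrightarrow> S \<subseteq> Q \<Longrightarrow> finite S \<Longrightarrow> (\<Sum>t\<in>S. \<bar>b i t\<bar>) \<le> C"
    unfolding type_c0l1_def by metis

  \<comment> \<open>The negative mass at the minimum of the cylinder lies in the interval up to
    \<open>t\<close>, the positive mass at the maximum lies beyond \<open>t\<close>.\<close>
  have F_prefix: "F (cyl (map t [0..<n])) t = -1" if "t \<in> Q" for t n
    using between[OF that, of n] lex_less_asym
    by (auto simp: F_def P_def N_def nbv_of_lex_return[OF z] indicator_def)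

  \<comment> \<open>At \<open>t\<close> only finitely many indices have \<open>a\<close> of size 1/2
    or more, and the prefixes of \<open>t\<close> give distinct indices. From some length on,
    \<open>b\<close> carries at least half of the value -1.\<close>
  have "\<exists>h. \<forall>n\<ge>h. 1/2 \<le> \<bar>b (cyl (map t [0..<n])) t\<bar>" if "t \<in> Q" for t
  proof -
    let ?i = "\<lambda>n. cyl (map t [0..<n])"
    have "inj ?i"
      by (rule injI) (metis injD[OF inj] length_map length_upt diff_zero)
    moreover have "finite {i\<in>I. 1/2 \<le> \<bar>a i t\<bar>}"
      using a[OF that, unfolded c0_fam_def, rule_format, of "1/2"] by simp
    ultimately have "finite (?i -` {i\<in>I. 1/2 \<le> \<bar>a i t\<bar>})"
      by (intro finite_vimageI)
    then obtain h where h: "\<forall>n\<in>?i -` {i\<in>I. 1/2 \<le> \<bar>a i t\<bar>}. n < h"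
      unfolding finite_nat_set_iff_bounded by (rule exE)
    have "1/2 \<le> \<bar>b (?i n) t\<bar>" if "n \<ge> h" for n
    proof -
      have "?i n \<in> I"
        by (simp add: I_def)
      moreover have "\<bar>a (?i n) t\<bar> < 1/2"
        using h that \<open>?i n \<in> I\<close> by force
      ultimately show ?thesis
        using F_prefix[OF \<open>t \<in> Q\<close>, of n] ab[of "?i n" t] \<open>t \<in> Q\<close> by linarith
    qed
    then show ?thesis
      by blast
  qed
  then obtain h where h: "\<And>t n. t \<in> Q \<Longrightarrow> n \<ge> h t \<Longrightarrow> 1/2 \<le> \<bar>b (cyl (map t [0..<n])) t\<bar>"
    by metis
  \<comment> \<open>All these \<open>t\<close> are tested at the single index \<open>cyl s\<close>,
    where each contributes at least 1/2 to a sum bounded by \<open>C\<close>. More than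
    \<open>2 * C\<close> of them are too many.\<close>
  obtain s where "uncountable {t\<in>Q. map t [0..<h t] = s}"
    using Q(3) by blast
  then have "infinite {t\<in>Q. map t [0..<h t] = s}"
    using countable_finite by blast
  then obtain S where S: "S \<subseteq> {t\<in>Q. map t [0..<h t] = s}" "finite S"
    "card S = nat \<lceil>2 * C\<rceil> + 1"
    using infinite_arbitrarily_large by blast
  have "real (card S) * (1/2) \<le> (\<Sum>t\<in>S. \<bar>b (cyl s) t\<bar>)"
    using S(1) h by (intro sum_bounded_below) force
  also have "\<dots> \<le> C"
    using S by (intro C) (auto simp: I_def)
  finally show False
    using S(3) by linarith
qed

end
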